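(* Let $n\ge1$, let $dw_1,\dots,dw_n$ be the quaternionic coordinate $1$-forms on $\mathbb{H}^n$ and let $\Omega_{ij}:=dw_i\wedge\overline{dw_j}$ for $1\le i,j\le n$. Then the Kraines $4$-form $\Omega$ on $\mathbb{H}^n$, regarded as an element of $\mathbb{H}\otimes\bigwedge^\bullet(\mathbb{H}^n)^*$, satisfies $$\Omega=-\frac14\sum_{i,j=1}^n\Omega_{ij}\wedge\overline{\Omega_{ij}}.$$
   Context: $\mathbb{H}$ is the algebra of quaternions with real orthonormal basis $\{1,e_1,e_2,e_4\}$, where $e_1,e_2,e_4$ anticommute pairwise, square to $-1$ and satisfy $e_1e_2=e_4$. The involution is $\overline1=1$, $\overline{e_j}=-e_j$, and $\langle u,v\rangle=\mathrm{Re}(u\overline v)$ with $\mathrm{Re}(u)=\frac12(u+\overline u)$. Kraines form: for $u=(u_1,\dots,u_n),v=(v_1,\dots,v_n)\in\mathbb{H}^n$ put $$\Omega_I(u,v):=\sum_{i=1}^n\langle u_ie_1,v_i\rangle,\quad \Omega_J(u,v):=\sum_{i=1}^n\langle u_ie_2,v_i\rangle,\quad \Omega_K(u,v):=\sum_{i=1}^n\langle u_ie_4,v_i\rangle .$$ These are real alternating $2$-forms on $\mathbb{H}^n$, and $\Omega:=\Omega_I\wedge\Omega_I+\Omega_J\wedge\Omega_J+\Omega_K\wedge\Omega_K$. Quaternion-valued forms: for a finite-dimensional real vector space $V$, $\mathbb{H}\otimes\bigwedge^\bullet V^*$ (tensor product over $\mathbb{R}$) carries the associative product $(u\otimes\varphi)\wedge(v\otimes\psi):=(uv)\otimes(\varphi\wedge\psi)$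 and the involution $\overline{u\otimes\varphi}:=\overline u\otimes\varphi$; real forms are identified with $\mathbb{R}1\otimes\bigwedge^\bullet V^*$. The wedge product of $1$-forms is normalised by $(\alpha\wedge\beta)(u,v)=\alpha(u)\beta(v)-\alpha(v)\beta(u)$ (determinant convention in general). The quaternionic coordinate forms $dw_i\in\mathbb{H}\otimes\bigwedge^1(\mathbb{H}^n)^*$ are defined by $dw_i(u):=u_i$. *)

theory Defs
  imports "HOL-Analysis.Analysis"
begin

section \<open>Quaternions\<close>

text \<open>The fields are the coordinates in the basis $1, e_1, e_2, e_4$, where $e_1 e_2 = e_4$.\<close>

datatype quat = Quat (q0: real) (q1: real) (q2: real) (q4: real)

lemma quat_eq_iff: "p = q \<longleftrightarrow> q0 p = q0 q \<and> q1 p = q1 q \<and> q2 p = q2 q \<and> q4 p = q4 q"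
  by (auto intro: quat.expand)

instantiation quat :: real_algebra_1
begin

definition "0 = Quat 0 0 0 0"
definition "1 = Quat 1 0 0 0"
definition "p + q = Quat (q0 p + q0 q) (q1 p + q1 q) (q2 p + q2 q) (q4 p + q4 q)"
definition "- p = Quat (- q0 p) (- q1 p) (- q2 p) (- q4 p)"
definition "p - q = Quat (q0 p - q0 q) (q1 p - q1 q) (q2 p - q2 q) (q4 p - q4 q)"
definition "r *\<^sub>R p = Quat (r * q0 p) (r * q1 p) (r * q2 p) (r * q4 p)"
definition "p * q = Quat
  (q0 p * q0 q - q1 p * q1 q - q2 p * q2 q - q4 p * q4 q)
  (q0 p * q1 q + q1 p * q0 q + q2 p * q4 q - q4 p * q2 q)
  (q0 p * q2 q - q1 p * q4 q + q2 p * q0 q + q4 p * q1 q)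
  (q0 p * q4 q + q1 p * q2 q - q2 p * q1 q + q4 p * q0 q)"

lemmas quat_defs = zero_quat_def one_quat_def plus_quat_def uminus_quat_def minus_quat_def
  scaleR_quat_def times_quat_def

instance
  by standard (simp_all add: quat_defs algebra_simps)

end

definition e1 :: quat where "e1 = Quat 0 1 0 0"
definition e2 :: quat where "e2 = Quat 0 0 1 0"
definition e4 :: quat where "e4 = Quat 0 0 0 1"

lemma quat_table:
  "e1 * e1 = -1" "e2 * e2 = -1" "e4 * e4 = -1"
  "e1 * e2 = e4" "e1 * e2 = - (e2 * e1)" "e1 * e4 = - (e4 * e1)" "e2 * e4 = - (e4 * e2)"
  by (simp_all add: e1_def e2_def e4_def quat_defs)

lemma quat_basis: "q = q0 q *\<^sub>R 1 + q1 q *\<^sub>R e1 + q2 q *\<^sub>R e2 + q4 q *\<^sub>R e4"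
  by (simp add: e1_def e2_def e4_def quat_defs)

definition qcnj :: "quat \<Rightarrow> quat"
  where "qcnj p = Quat (q0 p) (- q1 p) (- q2 p) (- q4 p)"

lemma qcnj_basis: "qcnj 1 = 1" "qcnj e1 = - e1" "qcnj e2 = - e2" "qcnj e4 = - e4"
  by (simp_all add: qcnj_def e1_def e2_def e4_def quat_defs)

lemma linear_qcnj: "linear qcnj"
  by (rule linearI) (simp_all add: qcnj_def quat_defs)

lemma qcnj_mult: "qcnj (p * q) = qcnj q * qcnj p"
  by (simp add: qcnj_def quat_defs algebra_simps)

text \<open>The real part is the coordinate \<^const>\<open>q0\<close>, as a real number rather than a real multiple of $1$.\<close>

lemma of_real_q0: "of_real (q0 u) = (1/2) *\<^sub>R (u + qcnj u)"
  by (simp add: of_real_def qcnj_def quat_defs)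

definition qinner :: "quat \<Rightarrow> quat \<Rightarrow> real"
  where "qinner u v = q0 (u * qcnj v)"

lemma qinner_coords: "qinner u v = q0 u * q0 v + q1 u * q1 v + q2 u * q2 v + q4 u * q4 v"
  by (simp add: qinner_def qcnj_def quat_defs)


section \<open>Exterior forms with values in a real algebra\<close>

text \<open>
  An element of $A \otimes \bigwedge^\bullet V^*$ is a function on lists of vectors whose
  restriction to lists of length $k$ is an alternating $k$-linear map $V^k \to A$, the component
  of degree $k$. For $V$ of finite dimension the components of degree above $\dim V$ vanish, so
  allowing a component in every degree yields the direct sum. Real forms are the case
  $A = \mathbb{R}$.
\<close>

definition alt_multilinear :: "('v::real_vector list \<Rightarrow> 'a::real_vector) \<Rightarrow> bool"
  where "alt_multilinear f \<longleftrightarrow>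
    (\<forall>vs i. i < length vs \<longrightarrow> linear (\<lambda>x. f (vs[i := x]))) \<and>
    (\<forall>vs. \<not> distinct vs \<longrightarrow> f vs = 0)"

lemma alt_multilinear_zero: "alt_multilinear (\<lambda>_. 0)"
  by (simp add: alt_multilinear_def linear_zero)

typedef (overloaded) ('v::real_vector, 'a::real_vector) form =
  "{f :: 'v list \<Rightarrow> 'a. alt_multilinear f}"
  morphisms form_apply Abs_form
  using alt_multilinear_zero by blast

setup_lifting type_definition_form

lemma form_eqI: "(\<And>vs. form_apply \<phi> vs = form_apply \<psi> vs) \<Longrightarrow> \<phi> = \<psi>"
  by (metis form_apply_inject ext)

lemma alt_multilinear_compose:
  assumes "linear h" "alt_multilinear f"
  shows "alt_multilinear (\<lambda>vs. h (f vs))"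
  using assms linear_compose[of _ h] by (auto simp: alt_multilinear_def o_def linear_0)

instantiation form :: (real_vector, real_vector) real_vector
begin

lift_definition zero_form :: "('a, 'b) form" is "\<lambda>_. 0"
  by (rule alt_multilinear_zero)

lift_definition plus_form :: "('a, 'b) form \<Rightarrow> ('a, 'b) form \<Rightarrow> ('a, 'b) form"
  is "\<lambda>f g vs. f vs + g vs"
  by (simp add: alt_multilinear_def linear_compose_add)

lift_definition uminus_form :: "('a, 'b) form \<Rightarrow> ('a, 'b) form" is "\<lambda>f vs. - f vs"
  by (simp add: alt_multilinear_def linear_compose_neg)

lift_definition minus_form :: "('a, 'b) form \<Rightarrow> ('a, 'b) form \<Rightarrow> ('a, 'b) form"
  is "\<lambda>f g vs. f vs - g vs"
  by (simp add: alt_multilinear_def linear_compose_sub)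

lift_definition scaleR_form :: "real \<Rightarrow> ('a, 'b) form \<Rightarrow> ('a, 'b) form" is "\<lambda>r f vs. r *\<^sub>R f vs"
  by (simp add: alt_multilinear_def linear_compose_scale_right)

instance
  by standard (transfer; simp add: fun_eq_iff algebra_simps)+

end

text \<open>
  The product is $(\varphi \wedge \psi)(v_1, \dots, v_m) = \sum_{k + l = m} \frac1{k!\,l!}
  \sum_\sigma \mathrm{sgn}(\sigma)\, \varphi(v_{\sigma 1}, \dots, v_{\sigma k})\,
  \psi(v_{\sigma(k+1)}, \dots, v_{\sigma m})$, which is the determinant convention.
\<close>

definition wedge_fun ::
    "('v list \<Rightarrow> 'a) \<Rightarrow> ('v list \<Rightarrow> 'a) \<Rightarrow> 'v list \<Rightarrow> 'a::real_algebra"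
  where "wedge_fun f g vs =
    (\<Sum>k\<le>length vs. (1 / (fact k * fact (length vs - k))) *\<^sub>R
      (\<Sum>\<sigma> | \<sigma> permutes {..<length vs}. real_of_int (sign \<sigma>) *\<^sub>R
        (f (take k (permute_list \<sigma> vs)) * g (drop k (permute_list \<sigma> vs)))))"

lemma alternating_sum_eq_0:
  fixes F :: "'v list \<Rightarrow> 'a::real_vector"
  assumes "\<not> distinct vs"
  shows "(\<Sum>\<sigma> | \<sigma> permutes {..<length vs}. real_of_int (sign \<sigma>) *\<^sub>R F (permute_list \<sigma> vs)) = 0"
    (is "?S = 0")
proof -
  obtain i j where ij: "i < length vs" "j < length vs" "i \<noteq> j" "vs ! i = vs ! j"
    using assms by (auto simp: distinct_conv_nth)
  let ?t = "Transposition.transpose i j"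
  have t: "?t permutes {..<length vs}"
    using ij by (intro permutes_swap_id) auto
  have pl: "permute_list (?t \<circ> \<sigma>) vs = permute_list \<sigma> vs" for \<sigma>
    using ij(4) by (auto simp: permute_list_def Transposition.transpose_def)
  have "?S = (\<Sum>\<sigma> | \<sigma> permutes {..<length vs}.
      real_of_int (sign (?t \<circ> \<sigma>)) *\<^sub>R F (permute_list (?t \<circ> \<sigma>) vs))"
    by (rule setum_permutations_compose_left[OF t])
  also have "\<dots> = (\<Sum>\<sigma> | \<sigma> permutes {..<length vs}.
      - (real_of_int (sign \<sigma>) *\<^sub>R F (permute_list \<sigma> vs)))"
  proof (rule sum.cong[OF refl])
    fix \<sigma> assume "\<sigma> \<in> {\<sigma>. \<sigma> permutes {..<length vs}}"
    hence "permutation \<sigma>" "permutation ?t"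
      using t permutation_permutes by blast+
    hence "sign (?t \<circ> \<sigma>) = - sign \<sigma>"
      using ij(3) by (simp add: sign_compose sign_swap_id)
    thus "real_of_int (sign (?t \<circ> \<sigma>)) *\<^sub>R F (permute_list (?t \<circ> \<sigma>) vs) =
        - (real_of_int (sign \<sigma>) *\<^sub>R F (permute_list \<sigma> vs))"
      by (simp only: pl) simp
  qed
  finally have "?S = - ?S"
    by (simp only: sum_negf)
  hence "2 *\<^sub>R ?S = 0"
    by (simp only: scaleR_2 eq_neg_iff_add_eq_0)
  thus ?thesis
    by simp
qed

lemma permute_list_update:
  assumes "\<sigma> permutes {..<length vs}" "i < length vs"
  shows "permute_list \<sigma> (vs[i := x]) = (permute_list \<sigma> vs)[inv \<sigma> i := x]"
    and "inv \<sigma> i < length vs"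
proof -
  show "inv \<sigma> i < length vs"
    using permutes_in_image[OF permutes_inv[OF assms(1)], of i] assms(2) by simp
  show "permute_list \<sigma> (vs[i := x]) = (permute_list \<sigma> vs)[inv \<sigma> i := x]"
  proof (rule nth_equalityI)
    fix m assume "m < length (permute_list \<sigma> (vs[i := x]))"
    moreover from this have "\<sigma> m < length vs"
      using permutes_in_image[OF assms(1), of m] by simp
    moreover have "i = \<sigma> m \<longleftrightarrow> inv \<sigma> i = m"
      using permutes_inv_eq[OF assms(1)] by metis
    ultimately show "permute_list \<sigma> (vs[i := x]) ! m = (permute_list \<sigma> vs)[inv \<sigma> i := x] ! m"
      using assms by (simp add: permute_list_def nth_list_update)
  qed simp
qed

lemma alt_multilinear_wedge_fun:
  fixes f g :: "'v::real_vector list \<Rightarrow> 'a::real_algebra"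
  assumes f: "alt_multilinear f" and g: "alt_multilinear g"
  shows "alt_multilinear (wedge_fun f g)"
  unfolding alt_multilinear_def
proof (intro conjI allI impI)
  fix vs :: "'v list" assume d: "\<not> distinct vs"
  show "wedge_fun f g vs = 0"
    unfolding wedge_fun_def
    using alternating_sum_eq_0[OF d, of "\<lambda>ws. f (take k ws) * g (drop k ws)" for k] by simp
next
  fix vs :: "'v list" and i assume i: "i < length vs"
  have lin: "linear (\<lambda>x. f (take k (permute_list \<sigma> (vs[i := x]))) *
      g (drop k (permute_list \<sigma> (vs[i := x]))))"
    if \<sigma>: "\<sigma> permutes {..<length vs}" for k \<sigma>
  proof (cases "inv \<sigma> i < k")
    case True
    have "linear (\<lambda>x. f ((take k (permute_list \<sigma> vs))[inv \<sigma> i := x]))"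
      using f True permute_list_update(2)[OF \<sigma> i] by (simp add: alt_multilinear_def)
    with True show ?thesis
      by (simp add: permute_list_update(1)[OF \<sigma> i] take_update_swap linear_iff distrib_right)
  next
    case False
    have "linear (\<lambda>x. g ((drop k (permute_list \<sigma> vs))[inv \<sigma> i - k := x]))"
      using g False permute_list_update(2)[OF \<sigma> i] by (simp add: alt_multilinear_def)
    with False show ?thesis
      by (simp add: permute_list_update(1)[OF \<sigma> i] drop_update_swap linear_iff distrib_left)
  qed
  show "linear (\<lambda>x. wedge_fun f g (vs[i := x]))"
    unfolding wedge_fun_def length_list_update
    by (intro linear_compose_sum ballI linear_compose_scale_right lin) auto
qed

lift_definition wedge :: "('v::real_vector, 'a::real_algebra) form \<Rightarrow> ('v, 'a) form \<Rightarrow> ('v, 'a) form"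
    (infixl "\<^bold>\<and>" 70)
  is wedge_fun
  by (rule alt_multilinear_wedge_fun)

lemma wedge_one_forms:
  assumes "\<And>vs. length vs \<noteq> 1 \<Longrightarrow> form_apply \<alpha> vs = 0"
    and "\<And>vs. length vs \<noteq> 1 \<Longrightarrow> form_apply \<beta> vs = 0"
  shows "form_apply (\<alpha> \<^bold>\<and> \<beta>) [u, v] =
    form_apply \<alpha> [u] * form_apply \<beta> [v] - form_apply \<alpha> [v] * form_apply \<beta> [u]"
proof -
  have A: "{..2::nat} = {0, 1, 2}"
    by auto
  have P: "{\<sigma>. \<sigma> permutes {..<Suc (Suc 0)}} = {id, Transposition.transpose 0 (Suc 0)}"
    by (auto simp: lessThan_Suc insert_commute permutes_doubleton_iff)
  have "id \<noteq> Transposition.transpose 0 (Suc 0)"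
    by (metis id_apply transpose_apply_first zero_neq_one One_nat_def)
  thus ?thesis
    by (simp add: wedge.rep_eq wedge_fun_def A P assms permute_list_def upt_rec
        sign_swap_id)
qed

text \<open>The pure tensor $u \otimes \varphi$; the real form $\varphi$ is identified with $1 \otimes \varphi$.\<close>

lift_definition tensor :: "'a::real_vector \<Rightarrow> ('v::real_vector, real) form \<Rightarrow> ('v, 'a) form"
  is "\<lambda>u f vs. f vs *\<^sub>R u"
  by (rule alt_multilinear_compose) (auto simp: linear_iff scaleR_add_left)

abbreviation of_real_form :: "('v::real_vector, real) form \<Rightarrow> ('v, 'a::real_algebra_1) form"
  where "of_real_form \<phi> \<equiv> tensor 1 \<phi>"

lemma wedge_tensor: "tensor u \<phi> \<^bold>\<and> tensor v \<psi> = tensor (u * v) (\<phi> \<^bold>\<and> \<psi>)"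
  by (rule form_eqI)
    (simp add: wedge.rep_eq tensor.rep_eq wedge_fun_def scaleR_sum_left scaleR_sum_right
      sum_distrib_left mult.assoc mult.commute mult.left_commute)

lift_definition form_cnj :: "('v::real_vector, quat) form \<Rightarrow> ('v, quat) form"
  is "\<lambda>f vs. qcnj (f vs)"
  by (rule alt_multilinear_compose[OF linear_qcnj])

lemma form_cnj_tensor: "form_cnj (tensor u \<phi>) = tensor (qcnj u) \<phi>"
  by (rule form_eqI) (simp add: form_cnj.rep_eq tensor.rep_eq linear_cmul[OF linear_qcnj])

text \<open>Every quaternion-valued form has unique real coordinate forms in the basis $1, e_1, e_2, e_4$.\<close>

lemma quat_form_tensor_basis:
  fixes \<omega> :: "('v::real_vector, quat) form"
  obtains a b c d where "\<omega> = tensor 1 a + tensor e1 b + tensor e2 c + tensor e4 d"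
proof -
  let ?c = "\<lambda>h :: quat \<Rightarrow> real. Abs_form (\<lambda>vs. h (form_apply \<omega> vs))"
  have c: "form_apply (?c h) = (\<lambda>vs. h (form_apply \<omega> vs))" if "linear h" for h
    using alt_multilinear_compose[OF that, of "form_apply \<omega>"] form_apply[of \<omega>]
    by (intro Abs_form_inverse) simp
  have lin: "linear q0" "linear q1" "linear q2" "linear q4"
    by (auto intro!: linearI simp: quat_defs)
  have "\<omega> = tensor 1 (?c q0) + tensor e1 (?c q1) + tensor e2 (?c q2) + tensor e4 (?c q4)"
    by (rule form_eqI)
      (simp only: plus_form.rep_eq tensor.rep_eq lin[THEN c] quat_basis[symmetric])
  thus thesis
    by (rule that)
qed

lemma quat_form_tensor_basis_unique:
  fixes a b c d a' b' c' d' :: "('v::real_vector, real) form"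
  assumes "tensor 1 a + tensor e1 b + tensor e2 c + tensor e4 d =
    tensor 1 a' + tensor e1 b' + tensor e2 c' + tensor e4 d'"
  shows "a = a'" "b = b'" "c = c'" "d = d'"
proof -
  have "form_apply a vs = form_apply a' vs \<and> form_apply b vs = form_apply b' vs \<and>
      form_apply c vs = form_apply c' vs \<and> form_apply d vs = form_apply d' vs" for vs
    using arg_cong[OF assms, of "\<lambda>\<phi>. form_apply \<phi> vs"]
    by (simp add: plus_form.rep_eq tensor.rep_eq e1_def e2_def e4_def quat_defs)
  thus "a = a'" "b = b'" "c = c'" "d = d'"
    by (auto intro: form_eqI)
qed


section \<open>The forms on quaternionic $n$-space\<close>

lemma alt_multilinear_degree_1:
  assumes "linear h"
  shows "alt_multilinear (\<lambda>vs. case vs of [u] \<Rightarrow> h u | _ \<Rightarrow> 0)"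
  unfolding alt_multilinear_def
proof (intro conjI allI impI)
  fix vs :: "'a list" and i
  assume i: "i < length vs"
  show "linear (\<lambda>x. case vs[i := x] of [u] \<Rightarrow> h u | _ \<Rightarrow> 0)"
  proof (cases "length vs = 1")
    case True
    with i assms show ?thesis
      by (auto simp: length_Suc_conv)
  next
    case False
    hence "length (vs[i := x]) \<noteq> 1" for x
      by simp
    moreover have "(case ws of [u] \<Rightarrow> h u | _ \<Rightarrow> 0) = 0" if "length ws \<noteq> 1" for ws
      using that by (auto split: list.split)
    ultimately have "(case vs[i := x] of [u] \<Rightarrow> h u | _ \<Rightarrow> 0) = 0" for x
      by blast
    thus ?thesis
      by (simp add: linear_zero)
  qed
qed (auto split: list.split)

lemma alt_multilinear_degree_2:
  assumes "\<And>v. linear (\<lambda>u. h u v)" "\<And>u. linear (h u)" "\<And>u. h u u = 0"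
  shows "alt_multilinear (\<lambda>vs. case vs of [u, v] \<Rightarrow> h u v | _ \<Rightarrow> 0)"
  unfolding alt_multilinear_def
proof (intro conjI allI impI)
  fix vs :: "'a list" and i
  assume i: "i < length vs"
  show "linear (\<lambda>x. case vs[i := x] of [u, v] \<Rightarrow> h u v | _ \<Rightarrow> 0)"
  proof (cases "\<exists>u v. vs = [u, v]")
    case True
    then obtain u v where uv: "vs = [u, v]"
      by blast
    with i consider "i = 0" | "i = 1"
      by fastforce
    thus ?thesis
      using assms(1)[of v] assms(2)[of u] by cases (simp_all add: uv)
  next
    case False
    hence "length vs \<noteq> 2"
      by (auto simp: eval_nat_numeral length_Suc_conv)
    hence "length (vs[i := x]) \<noteq> 2" for x
      by simp
    moreover have "(case ws of [u, v] \<Rightarrow> h u v | _ \<Rightarrow> 0) = 0" if "length ws \<noteq> 2" for ws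
      using that by (auto split: list.split)
    ultimately have "(case vs[i := x] of [u, v] \<Rightarrow> h u v | _ \<Rightarrow> 0) = 0" for x
      by blast
    thus ?thesis
      by (simp add: linear_zero)
  qed
qed (auto simp: assms(3) split: list.split)

lemma alt_multilinear_qinner:
  assumes "qcnj e = - e"
  shows "alt_multilinear (\<lambda>vs :: (quat ^ 'n::finite) list.
    case vs of [u, v] \<Rightarrow> \<Sum>i\<in>UNIV. qinner (u $ i * e) (v $ i) | _ \<Rightarrow> 0)"
proof (rule alt_multilinear_degree_2)
  have "qinner (p * e) p = 0" for p
    using assms by (simp add: qinner_coords qcnj_def quat_defs algebra_simps)
  thus "(\<Sum>i\<in>UNIV. qinner (u $ i * e) (u $ i)) = 0" for u :: "quat ^ 'n"
    by simp
  show "linear (\<lambda>u :: quat ^ 'n. \<Sum>i\<in>UNIV. qinner (u $ i * e) (v $ i))" for v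
    by (intro linear_compose_sum ballI linearI)
      (simp_all add: qinner_coords quat_defs algebra_simps)
  show "linear (\<lambda>v :: quat ^ 'n. \<Sum>i\<in>UNIV. qinner (u $ i * e) (v $ i))" for u
    by (intro linear_compose_sum ballI linearI)
      (simp_all add: qinner_coords quat_defs algebra_simps)
qed

lift_definition dw :: "'n::finite \<Rightarrow> (quat ^ 'n, quat) form"
  is "\<lambda>i vs. case vs of [u] \<Rightarrow> u $ i | _ \<Rightarrow> 0"
  by (intro alt_multilinear_degree_1 linearI) simp_all

definition Omega_ij :: "'n::finite \<Rightarrow> 'n \<Rightarrow> (quat ^ 'n, quat) form"
  where "Omega_ij i j = dw i \<^bold>\<and> form_cnj (dw j)"

lift_definition Omega_I :: "(quat ^ 'n::finite, real) form"
  is "\<lambda>vs. case vs of [u, v] \<Rightarrow> \<Sum>i\<in>UNIV. qinner (u $ i * e1) (v $ i) | _ \<Rightarrow> 0"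
  by (rule alt_multilinear_qinner) (rule qcnj_basis)

lift_definition Omega_J :: "(quat ^ 'n::finite, real) form"
  is "\<lambda>vs. case vs of [u, v] \<Rightarrow> \<Sum>i\<in>UNIV. qinner (u $ i * e2) (v $ i) | _ \<Rightarrow> 0"
  by (rule alt_multilinear_qinner) (rule qcnj_basis)

lift_definition Omega_K :: "(quat ^ 'n::finite, real) form"
  is "\<lambda>vs. case vs of [u, v] \<Rightarrow> \<Sum>i\<in>UNIV. qinner (u $ i * e4) (v $ i) | _ \<Rightarrow> 0"
  by (rule alt_multilinear_qinner) (rule qcnj_basis)

definition Kraines :: "(quat ^ 'n::finite, real) form"
  where "Kraines = Omega_I \<^bold>\<and> Omega_I + Omega_J \<^bold>\<and> Omega_J + Omega_K \<^bold>\<and> Omega_K"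

end

theory Submission
  imports Defs
begin

text \<open>
  The identity already holds for every pair $(i,j)$ before summation. Under the alternating sum,
  $\Omega_{ij} \wedge \overline{\Omega_{ij}}$ becomes
  $-dw_i \wedge \overline{dw_j} \wedge dw_j \wedge \overline{dw_i}$. The inner product
  $\overline{dw_j} \wedge dw_j$ is purely imaginary, and its coordinates are twice the $j$-th
  summands of the three Kaehler forms; moving the unit $e$ between the outer factors,
  $dw_i\, e \wedge \overline{dw_i}$ is real and twice the $i$-th summand of the Kaehler form
  of $e$.
\<close>

section \<open>Alternating sums over permutations\<close>

definition alt_sum :: "('v list \<Rightarrow> 'a::real_vector) \<Rightarrow> 'v list \<Rightarrow> 'a"
  where "alt_sum F vs =
    (\<Sum>\<sigma> | \<sigma> permutes {..<length vs}. real_of_int (sign \<sigma>) *\<^sub>R F (permute_list \<sigma> vs))"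

lemma alt_sum_cong:
  assumes "\<And>ws. length ws = length vs \<Longrightarrow> F ws = G ws"
  shows "alt_sum F vs = alt_sum G vs"
  unfolding alt_sum_def using assms by (intro sum.cong) auto

text \<open>Reindexing by \<open>\<sigma> \<circ> \<tau>\<close> turns a permutation of the argument
  slots of \<open>F\<close> into the sign of \<open>\<tau>\<close>, because
  \<open>permute_list\<close> composes contravariantly.\<close>

lemma alt_sum_permute:
  assumes "\<tau> permutes {..<length vs}"
  shows "alt_sum F vs = real_of_int (sign \<tau>) *\<^sub>R alt_sum (\<lambda>ws. F (permute_list \<tau> ws)) vs"
proof -
  have "alt_sum F vs = (\<Sum>\<sigma> | \<sigma> permutes {..<length vs}.
      real_of_int (sign (\<sigma> \<circ> \<tau>)) *\<^sub>R F (permute_list (\<sigma> \<circ> \<tau>) vs))"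
    unfolding alt_sum_def by (rule sum_permutations_compose_right[OF assms])
  also have "\<dots> = (\<Sum>\<sigma> | \<sigma> permutes {..<length vs}.
      real_of_int (sign \<tau>) *\<^sub>R real_of_int (sign \<sigma>) *\<^sub>R F (permute_list \<tau> (permute_list \<sigma> vs)))"
  proof (rule sum.cong[OF refl])
    fix \<sigma> assume "\<sigma> \<in> {\<sigma>. \<sigma> permutes {..<length vs}}"
    hence "permutation \<sigma>" "permutation \<tau>"
      using assms permutation_permutes by blast+
    thus "real_of_int (sign (\<sigma> \<circ> \<tau>)) *\<^sub>R F (permute_list (\<sigma> \<circ> \<tau>) vs) =
        real_of_int (sign \<tau>) *\<^sub>R real_of_int (sign \<sigma>) *\<^sub>R F (permute_list \<tau> (permute_list \<sigma> vs))"
      using assms by (simp add: sign_compose permute_list_compose)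
  qed
  finally show ?thesis
    by (simp add: alt_sum_def scaleR_sum_right)
qed

section \<open>Products of homogeneous forms\<close>

definition homogeneous :: "nat \<Rightarrow> ('v::real_vector, 'a::real_vector) form \<Rightarrow> bool"
  where "homogeneous p \<phi> \<longleftrightarrow> (\<forall>vs. length vs \<noteq> p \<longrightarrow> form_apply \<phi> vs = 0)"

text \<open>Of all splittings in \<open>wedge_fun\<close> only \<open>k = p\<close> can survive: any
  other hands \<open>\<phi>\<close> a list of the wrong length, and for \<open>k = p\<close> the
  rest fits \<open>\<psi>\<close> only in total degree \<open>p + q\<close>.\<close>

lemma form_apply_wedge:
  fixes \<phi> \<psi> :: "('v::real_vector, 'a::real_algebra) form"
  assumes \<phi>: "homogeneous p \<phi>" and \<psi>: "homogeneous q \<psi>"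
  shows "form_apply (\<phi> \<^bold>\<and> \<psi>) vs = (if length vs = p + q then (1 / (fact p * fact q)) *\<^sub>R
    alt_sum (\<lambda>ws. form_apply \<phi> (take p ws) * form_apply \<psi> (drop p ws)) vs else 0)"
proof -
  let ?A = "\<lambda>k. (1 / (fact k * fact (length vs - k))) *\<^sub>R
    alt_sum (\<lambda>ws. form_apply \<phi> (take k ws) * form_apply \<psi> (drop k ws)) vs"
  have 0: "?A k = 0" if "k \<le> length vs" "\<not> (k = p \<and> length vs = p + q)" for k
  proof -
    have "form_apply \<phi> (take k ws) * form_apply \<psi> (drop k ws) = 0"
      if "length ws = length vs" for ws
    proof (cases "k = p")
      case True
      hence "length (drop k ws) \<noteq> q"
        using \<open>\<not> _\<close> \<open>k \<le> _\<close> that by auto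
      thus ?thesis
        using \<psi> by (simp add: homogeneous_def)
    next
      case False
      hence "length (take k ws) \<noteq> p"
        using \<open>k \<le> _\<close> that by auto
      thus ?thesis
        using \<phi> by (simp add: homogeneous_def)
    qed
    thus ?thesis
      by (simp add: alt_sum_def)
  qed
  have S: "form_apply (\<phi> \<^bold>\<and> \<psi>) vs = (\<Sum>k\<le>length vs. ?A k)"
    by (simp add: wedge.rep_eq wedge_fun_def alt_sum_def)
  show ?thesis
  proof (cases "length vs = p + q")
    case True
    hence "(\<Sum>k\<le>length vs. ?A k) = (\<Sum>k\<in>{p}. ?A k)"
      using 0 by (intro sum.mono_neutral_right) auto
    with S True show ?thesis
      by simp
  next
    case False
    thus ?thesis
      unfolding S using 0 by (auto intro!: sum.neutral)
  qed
qed

lemma homogeneous_wedge: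
  fixes \<phi> \<psi> :: "('v::real_vector, 'a::real_algebra) form"
  assumes "homogeneous p \<phi>" "homogeneous q \<psi>"
  shows "homogeneous (p + q) (\<phi> \<^bold>\<and> \<psi>)"
  unfolding homogeneous_def by (simp add: form_apply_wedge[OF assms])

section \<open>Alternating sums in four named slots\<close>

text \<open>Named slots turn a reordering of arguments into a renaming of bound variables. The
  intended lists have length 4, giving 24 terms.\<close>

definition alt4 :: "'v list \<Rightarrow> ('v \<Rightarrow> 'v \<Rightarrow> 'v \<Rightarrow> 'v \<Rightarrow> 'a::real_vector) \<Rightarrow> 'a"
  where "alt4 vs f = alt_sum (\<lambda>ws. f (ws ! 0) (ws ! 1) (ws ! 2) (ws ! 3)) vs"

lemma alt4_diff: "alt4 vs (\<lambda>a b c d. f a b c d - g a b c d) = alt4 vs f - alt4 vs g"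
  by (simp add: alt4_def alt_sum_def scaleR_diff_right sum_subtractf)

lemma alt4_scaleR: "alt4 vs (\<lambda>a b c d. r *\<^sub>R f a b c d) = r *\<^sub>R alt4 vs f"
  by (simp add: alt4_def alt_sum_def scaleR_sum_right mult.commute)

lemma alt4_sum: "alt4 vs (\<lambda>a b c d. \<Sum>i\<in>I. f i a b c d) = (\<Sum>i\<in>I. alt4 vs (f i))"
  by (simp add: alt4_def alt_sum_def scaleR_sum_right sum.swap[of _ I])

lemma alt4_transpose:
  assumes "length vs = 4" "i < 4" "j < 4" "i \<noteq> j"
  shows "alt4 vs f = - alt_sum (\<lambda>ws.
    f (ws ! Transposition.transpose i j 0) (ws ! Transposition.transpose i j 1)
      (ws ! Transposition.transpose i j 2) (ws ! Transposition.transpose i j 3)) vs"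
proof -
  let ?t = "Transposition.transpose i j"
  have t: "?t permutes {..<length vs}"
    using assms by (intro permutes_swap_id) auto
  have "alt4 vs f = - alt_sum (\<lambda>ws. f (permute_list ?t ws ! 0) (permute_list ?t ws ! 1)
      (permute_list ?t ws ! 2) (permute_list ?t ws ! 3)) vs"
    unfolding alt4_def by (subst alt_sum_permute[OF t]) (simp add: sign_swap_id assms)
  also have "\<dots> = - alt_sum (\<lambda>ws. f (ws ! ?t 0) (ws ! ?t 1) (ws ! ?t 2) (ws ! ?t 3)) vs"
    using t assms(1)
    by (intro arg_cong[of _ _ uminus] alt_sum_cong) (simp add: permute_list_nth)
  finally show ?thesis .
qed

text \<open>The first three transpositions reorder expanded products; the last exchanges the two
  outer factors while keeping the inner ones fixed.\<close>

lemma alt4_swap: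
  assumes "length vs = 4"
  shows "alt4 vs f = - alt4 vs (\<lambda>a b c d. f b a c d)"
    and "alt4 vs f = - alt4 vs (\<lambda>a b c d. f a c b d)"
    and "alt4 vs f = - alt4 vs (\<lambda>a b c d. f a b d c)"
    and "alt4 vs f = - alt4 vs (\<lambda>a b c d. f d b c a)"
  using alt4_transpose[OF assms, of 0 1 f] alt4_transpose[OF assms, of 1 2 f]
    alt4_transpose[OF assms, of 2 3 f] alt4_transpose[OF assms, of 0 3 f]
  by (simp_all add: alt4_def Transposition.transpose_def)

text \<open>The coefficient 1/4 is 1/(2! 2!).\<close>

lemma wedge_two_forms:
  fixes \<phi> \<psi> :: "('v::real_vector, 'a::real_algebra) form"
  assumes "homogeneous 2 \<phi>" "homogeneous 2 \<psi>"
  shows "form_apply (\<phi> \<^bold>\<and> \<psi>) vs = (if length vs = 4 then (1/4) *\<^sub>R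
    alt4 vs (\<lambda>a b c d. form_apply \<phi> [a, b] * form_apply \<psi> [c, d]) else 0)"
proof (cases "length vs = 4")
  case True
  have "take 2 ws = [ws ! 0, ws ! 1]" "drop 2 ws = [ws ! 2, ws ! 3]"
    if "length ws = 4" for ws :: "'v list"
    using that by (auto simp: eval_nat_numeral length_Suc_conv)
  hence "alt_sum (\<lambda>ws. form_apply \<phi> (take 2 ws) * form_apply \<psi> (drop 2 ws)) vs =
      alt4 vs (\<lambda>a b c d. form_apply \<phi> [a, b] * form_apply \<psi> [c, d])"
    unfolding alt4_def using True by (intro alt_sum_cong) simp
  thus ?thesis
    using True by (simp add: form_apply_wedge[OF assms])
qed (simp add: form_apply_wedge[OF assms])

section \<open>Two quaternion identities for the inner and the outer pair\<close>

text \<open>With \<open>x = qcnj p * q\<close> the left side is \<open>x - qcnj x\<close>, twice the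
  imaginary part of \<open>x\<close>. Left multiplications by \<open>p\<close> and
  \<open>qcnj p\<close> are adjoint, so the coordinate of \<open>x\<close> along \<open>e\<close> is
  \<open>qinner (p * e) q\<close>.\<close>

lemma qcnj_mult_alternating:
  "qcnj p * q - qcnj q * p = 2 *\<^sub>R (\<Sum>e\<in>{e1, e2, e4}. qinner (p * e) q *\<^sub>R e)"
proof -
  \<comment> \<open>Distinctness lets the sum over the set split into three terms.\<close>
  have "e1 \<noteq> e2" "e1 \<noteq> e4" "e2 \<noteq> e4"
    by (simp_all add: e1_def e2_def e4_def)
  thus ?thesis
    by (simp add: qinner_coords qcnj_def e1_def e2_def e4_def quat_defs algebra_simps)
qed

text \<open>With \<open>x = p * e * qcnj q\<close> and \<open>e\<close> imaginary,
  \<open>qcnj x = - (q * e * qcnj p)\<close>, so the left side is \<open>x + qcnj x\<close>, twice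
  the real part of \<open>x\<close>.\<close>

lemma mult_qcnj_alternating:
  assumes "qcnj e = - e"
  shows "p * e * qcnj q - q * e * qcnj p = (2 * qinner (p * e) q) *\<^sub>R 1"
  using assms by (simp add: qinner_coords qcnj_def quat_defs algebra_simps)

section \<open>The identity for a single pair of indices\<close>

lemma homogeneous_dw: "homogeneous 1 (dw i)"
  by (auto simp: homogeneous_def dw.rep_eq split: list.split)

lemma homogeneous_form_cnj: "homogeneous p \<phi> \<Longrightarrow> homogeneous p (form_cnj \<phi>)"
  by (simp add: homogeneous_def form_cnj.rep_eq linear_0[OF linear_qcnj])

lemma homogeneous_Omega_ij: "homogeneous 2 (Omega_ij i j)"
  using homogeneous_wedge[OF homogeneous_dw homogeneous_form_cnj[OF homogeneous_dw], of i j]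
  by (simp add: Omega_ij_def numeral_2_eq_2)

lemma form_apply_Omega_ij:
  "form_apply (Omega_ij i j) [u, v] = u $ i * qcnj (v $ j) - v $ i * qcnj (u $ j)"
proof -
  have "form_apply (Omega_ij i j) [u, v] =
      form_apply (dw i) [u] * form_apply (form_cnj (dw j)) [v] -
      form_apply (dw i) [v] * form_apply (form_cnj (dw j)) [u]"
    unfolding Omega_ij_def using homogeneous_dw[of i] homogeneous_form_cnj[OF homogeneous_dw, of j]
    by (intro wedge_one_forms) (auto simp: homogeneous_def)
  thus ?thesis
    by (simp add: form_cnj.rep_eq dw.rep_eq)
qed

text \<open>The inner factors produce the index \<open>j\<close>, the outer ones the index
  \<open>i\<close>. The unit \<open>e\<close> coming from the inner pair is the one enclosed by the
  outer pair, so only products belonging to the same unit occur.\<close>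

lemma alt4_Omega_ij:
  fixes vs :: "(quat ^ 'n::finite) list"
  assumes vs: "length vs = 4"
  shows "alt4 vs (\<lambda>a b c d. form_apply (Omega_ij i j) [a, b] *
      qcnj (form_apply (Omega_ij i j) [c, d])) =
    - 4 *\<^sub>R (\<Sum>e\<in>{e1, e2, e4}. alt4 vs (\<lambda>a b c d.
      (qinner (a $ j * e) (b $ j) * qinner (c $ i * e) (d $ i)) *\<^sub>R 1))"
proof -
  let ?Q = "\<lambda>e k u v. qinner (u $ k * e) (v $ k)"
  let ?P = "\<lambda>a b c d :: quat ^ 'n. a $ i * qcnj (b $ j) * (c $ j) * qcnj (d $ i)"
  let ?R = "\<lambda>e a b c d. ?Q e j b c *\<^sub>R (a $ i * e * qcnj (d $ i))"
  have cnj: "qcnj (p * qcnj q - r * qcnj s) = q * qcnj p - s * qcnj r" for p q r s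
    by (simp add: qcnj_def quat_defs algebra_simps)
  have "alt4 vs (\<lambda>a b c d. form_apply (Omega_ij i j) [a, b] *
        qcnj (form_apply (Omega_ij i j) [c, d])) =
      alt4 vs (\<lambda>a b c d. (?P a b d c - ?P a b c d) - (?P b a d c - ?P b a c d))"
    by (simp add: form_apply_Omega_ij cnj algebra_simps)
  \<comment> \<open>Each of the four products, taken with its sign, alternates to
    \<open>- alt4 vs ?P\<close>: the two odd reorderings of \<open>?P\<close> enter with plus, the
    identity and the double swap with minus.\<close>
  also have "\<dots> = - (2 *\<^sub>R 2 *\<^sub>R alt4 vs ?P)"
    unfolding scaleR_2
    using alt4_swap(1)[OF vs, of ?P] alt4_swap(3)[OF vs, of ?P]
      alt4_swap(1)[OF vs, of "\<lambda>a b c d. ?P a b d c"]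
    by (simp add: alt4_diff)
  also have "\<dots> = - 4 *\<^sub>R alt4 vs ?P"
    by simp
  also have "alt4 vs ?P = (\<Sum>e\<in>{e1, e2, e4}. alt4 vs (?R e))"
  proof -
    \<comment> \<open>Doubling makes room to antisymmetrise in the middle slots, which exposes the
      left side of \<open>qcnj_mult_alternating\<close>.\<close>
    have "2 *\<^sub>R alt4 vs ?P = alt4 vs (\<lambda>a b c d. ?P a b c d - ?P a c b d)"
      using alt4_swap(2)[OF vs, of ?P] by (simp add: alt4_diff scaleR_2)
    also have "\<dots> = alt4 vs (\<lambda>a b c d.
        a $ i * (qcnj (b $ j) * c $ j - qcnj (c $ j) * b $ j) * qcnj (d $ i))"
      by (simp add: algebra_simps)
    also have "\<dots> = 2 *\<^sub>R (\<Sum>e\<in>{e1, e2, e4}. alt4 vs (?R e))"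
      unfolding qcnj_mult_alternating
      by (simp only: alt4_scaleR alt4_sum mult_scaleR_left mult_scaleR_right
          sum_distrib_left sum_distrib_right)
    finally show ?thesis
      by simp
  qed
  also have "\<dots> = (\<Sum>e\<in>{e1, e2, e4}. alt4 vs (\<lambda>a b c d. (?Q e j a b * ?Q e i c d) *\<^sub>R 1))"
  proof (rule sum.cong[OF refl])
    fix e assume "e \<in> {e1, e2, e4}"
    hence e: "qcnj e = - e"
      using qcnj_basis by auto
    let ?S = "\<lambda>a b c d. (?Q e j a b * ?Q e i c d) *\<^sub>R (1::quat)"
    \<comment> \<open>The same device in the outer slots: \<open>?Q e j b c\<close> is untouched by
      the swap, and the difference is real by \<open>mult_qcnj_alternating\<close>.\<close>
    have "2 *\<^sub>R alt4 vs (?R e) = alt4 vs (\<lambda>a b c d. ?R e a b c d - ?R e d b c a)"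
      using alt4_swap(4)[OF vs, of "?R e"] by (simp add: alt4_diff scaleR_2)
    also have "\<dots> = alt4 vs (\<lambda>a b c d. 2 *\<^sub>R ?S b c a d)"
      by (simp only: scaleR_diff_right[symmetric] mult_qcnj_alternating[OF e])
        (simp add: mult.left_commute)
    \<comment> \<open>The order \<open>b c a d\<close> is a 3-cycle, hence even; two adjacent swaps
      undo it without a sign.\<close>
    also have "\<dots> = 2 *\<^sub>R alt4 vs ?S"
      using alt4_swap(2)[OF vs, of ?S] alt4_swap(1)[OF vs, of "\<lambda>a b c d. ?S a c b d"]
      by (simp only: alt4_scaleR minus_minus)
    finally show "alt4 vs (?R e) = alt4 vs ?S"
      by simp
  qed
  finally show ?thesis .
qed

section \<open>The Kraines form and the summation over all pairs\<close>

text \<open>Treats the three Kaehler forms uniformly through their unit \<open>e\<close>. The square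
  is computed among quaternion-valued forms so that its summands are literally those of
  \<open>alt4_Omega_ij\<close>.\<close>

lemma wedge_square_qinner:
  fixes \<phi> :: "(quat ^ 'n::finite, real) form"
  assumes "form_apply \<phi> =
    (\<lambda>vs. case vs of [u, v] \<Rightarrow> \<Sum>i\<in>UNIV. qinner (u $ i * e) (v $ i) | _ \<Rightarrow> 0)"
  shows "form_apply (of_real_form (\<phi> \<^bold>\<and> \<phi>) :: (quat ^ 'n, quat) form) vs =
    (if length vs = 4 then (1/4) *\<^sub>R (\<Sum>i\<in>UNIV. \<Sum>j\<in>UNIV. alt4 vs (\<lambda>a b c d.
      (qinner (a $ j * e) (b $ j) * qinner (c $ i * e) (d $ i)) *\<^sub>R 1)) else 0)"
proof -
  let ?\<phi> = "of_real_form \<phi> :: (quat ^ 'n, quat) form"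
  have hom: "homogeneous 2 ?\<phi>"
    by (auto simp: homogeneous_def tensor.rep_eq assms split: list.split)
  have "of_real_form (\<phi> \<^bold>\<and> \<phi>) = ?\<phi> \<^bold>\<and> ?\<phi>"
    by (simp add: wedge_tensor)
  \<comment> \<open>The first factor is expanded with index \<open>j\<close> and the second with
    \<open>i\<close>, to match \<open>alt4_Omega_ij\<close>; hence the exchange of sums.\<close>
  moreover have "form_apply ?\<phi> [a, b] * form_apply ?\<phi> [c, d] =
      (\<Sum>i\<in>UNIV. \<Sum>j\<in>UNIV. (qinner (a $ j * e) (b $ j) * qinner (c $ i * e) (d $ i)) *\<^sub>R 1)"
    for a b c d
    by (simp add: tensor.rep_eq assms sum_product scaleR_sum_left mult.commute)
      (rule sum.swap)
  ultimately show ?thesis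
    by (simp only: wedge_two_forms[OF hom hom] alt4_sum)
qed

lemma form_apply_sum: "form_apply (\<Sum>i\<in>I. \<phi> i) vs = (\<Sum>i\<in>I. form_apply (\<phi> i) vs)"
  by (induction I rule: infinite_finite_induct) (simp_all add: zero_form.rep_eq plus_form.rep_eq)

theorem mainTheorem2:
  shows "(of_real_form Kraines :: (quat ^ 'n::finite, quat) form) =
    - (1/4) *\<^sub>R (\<Sum>i\<in>UNIV. \<Sum>j\<in>UNIV. Omega_ij i j \<^bold>\<and> form_cnj (Omega_ij i j))"
proof (rule form_eqI)
  fix vs :: "(quat ^ 'n) list"
  let ?W = "\<lambda>e i j. alt4 vs (\<lambda>a b c d.
    (qinner (a $ j * e) (b $ j) * qinner (c $ i * e) (d $ i)) *\<^sub>R (1::quat))"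
  have distinct: "e1 \<noteq> e2" "e1 \<noteq> e4" "e2 \<noteq> e4"
    by (simp_all add: e1_def e2_def e4_def)
  have "form_apply (of_real_form Kraines :: (quat ^ 'n, quat) form) vs =
      form_apply (of_real_form (Omega_I \<^bold>\<and> Omega_I) :: (quat ^ 'n, quat) form) vs +
      form_apply (of_real_form (Omega_J \<^bold>\<and> Omega_J) :: (quat ^ 'n, quat) form) vs +
      form_apply (of_real_form (Omega_K \<^bold>\<and> Omega_K) :: (quat ^ 'n, quat) form) vs"
    by (simp add: Kraines_def tensor.rep_eq plus_form.rep_eq scaleR_add_left)
  also have "\<dots> = (if length vs = 4 then
      (1/4) *\<^sub>R (\<Sum>i\<in>UNIV. \<Sum>j\<in>UNIV. \<Sum>e\<in>{e1, e2, e4}. ?W e i j) else 0)"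
    using distinct
    by (simp add: wedge_square_qinner[OF Omega_I.rep_eq] wedge_square_qinner[OF Omega_J.rep_eq]
        wedge_square_qinner[OF Omega_K.rep_eq] sum.distrib scaleR_add_right add.assoc)
  also have "\<dots> = - (1/4) *\<^sub>R (\<Sum>i\<in>UNIV. \<Sum>j\<in>UNIV.
      form_apply (Omega_ij i j \<^bold>\<and> form_cnj (Omega_ij i j)) vs)"
  proof (cases "length vs = 4")
    case True
    \<comment> \<open>The 1/4 of the wedge cancels the 4 of \<open>alt4_Omega_ij\<close> and leaves
      only the sign.\<close>
    have "form_apply (Omega_ij i j \<^bold>\<and> form_cnj (Omega_ij i j)) vs =
        - (\<Sum>e\<in>{e1, e2, e4}. ?W e i j)" for i j
      unfolding wedge_two_forms[OF homogeneous_Omega_ij homogeneous_form_cnj[OF homogeneous_Omega_ij]]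
        form_cnj.rep_eq alt4_Omega_ij[OF True] using True by simp
    thus ?thesis
      using True by (simp add: sum_negf)
  next
    \<comment> \<open>Away from degree 4 both sides vanish.\<close>
    case False
    thus ?thesis
      by (simp add: wedge_two_forms homogeneous_Omega_ij homogeneous_form_cnj)
  qed
  finally show "form_apply (of_real_form Kraines) vs = form_apply (- (1/4) *\<^sub>R
      (\<Sum>i\<in>UNIV. \<Sum>j\<in>UNIV. Omega_ij i j \<^bold>\<and> form_cnj (Omega_ij i j))) vs"
    by (simp add: scaleR_form.rep_eq uminus_form.rep_eq form_apply_sum)
qed

end
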